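(* Let $L$ and $R$ be strongly connected oriented graphs such that $\operatorname{inv}(L)\geq 2$ and $\operatorname{inv}(R)\geq 2$. Then $\operatorname{inv}(L\rightarrow R)\geq 4$.
   Context: An oriented graph is a digraph with no loops, no multiple arcs and no directed cycle of length 2. Inverting a vertex set $X$ means reversing every arc with both ends in $X$. $\operatorname{inv}(D)$ is the minimum number of successive inversions needed to make the oriented graph $D$ acyclic. The dijoin $L\rightarrow R$ is obtained from the disjoint union of $L$ and $R$ by adding all arcs from $V(L)$ to $V(R)$. *)

theory Defs
  imports "Graph_Theory.Graph_Theory"
begin

text \<open>
  Arcs are ordered pairs of vertices, so multiple arcs are excluded by construction; the locale
  \<^locale>\<open>pair_digraph\<close> requires finiteness and excludes loops.
\<close>

locale oriented_graph = pair_digraph D for D :: "'a pair_pre_digraph" +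
  assumes no_2cycle: "(u, v) \<in> parcs D \<Longrightarrow> (v, u) \<notin> parcs D"

definition invert :: "'a set \<Rightarrow> 'a pair_pre_digraph \<Rightarrow> 'a pair_pre_digraph" where
  "invert X D = \<lparr> pverts = pverts D,
     parcs = {(u, v). (u, v) \<in> parcs D \<and> \<not> (u \<in> X \<and> v \<in> X)}
           \<union> {(v, u) | u v. (u, v) \<in> parcs D \<and> u \<in> X \<and> v \<in> X} \<rparr>"

definition acyclic_digraph :: "'a pair_pre_digraph \<Rightarrow> bool" where
  "acyclic_digraph D \<longleftrightarrow> (\<nexists>p. pre_digraph.cycle (with_proj D) p)"

definition decycling_family :: "'a set list \<Rightarrow> 'a pair_pre_digraph \<Rightarrow> bool" where
  "decycling_family Xs D \<longleftrightarrow>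
     (\<forall>X \<in> set Xs. X \<subseteq> pverts D) \<and> acyclic_digraph (fold invert Xs D)"

text \<open>
  For an oriented graph the minimum ranges over a nonempty set, see
  \<open>oriented_graph.ex_decycling_family\<close> below.
\<close>

definition inversion_number :: "'a pair_pre_digraph \<Rightarrow> nat" where
  "inversion_number D = (LEAST k. \<exists>Xs. length Xs = k \<and> decycling_family Xs D)"

definition dijoin :: "'a pair_pre_digraph \<Rightarrow> 'b pair_pre_digraph \<Rightarrow> ('a + 'b) pair_pre_digraph" where
  "dijoin L R = \<lparr> pverts = pverts L <+> pverts R,
     parcs = map_prod Inl Inl ` parcs L \<union> map_prod Inr Inr ` parcs R
           \<union> (Inl ` pverts L) \<times> (Inr ` pverts R) \<rparr>"

lemma invert_simps [simp]:
  "pverts (invert X D) = pverts D"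
  "(u, v) \<in> parcs (invert X D) \<longleftrightarrow>
     (if u \<in> X \<and> v \<in> X then (v, u) \<in> parcs D else (u, v) \<in> parcs D)"
  by (auto simp: invert_def)

lemma oriented_graph_iff:
  "oriented_graph D \<longleftrightarrow> finite (pverts D) \<and> parcs D \<subseteq> pverts D \<times> pverts D \<and>
     (\<forall>u v. (u, v) \<in> parcs D \<longrightarrow> u \<noteq> v \<and> (v, u) \<notin> parcs D)" (is "?l \<longleftrightarrow> ?r")
proof
  assume ?l
  then interpret oriented_graph D .
  show ?r
    using pair_finite_verts arc_fst_in_verts arc_snd_in_verts pair_no_loops no_2cycle by fastforce
next
  assume r: ?r
  then have "finite (parcs D)"
    by (meson finite_SigmaI finite_subset)
  with r show ?l
    by unfold_locales force+
qed

lemma oriented_graph_invert: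
  assumes "oriented_graph D"
  shows "oriented_graph (invert X D)"
  using assms unfolding oriented_graph_iff by (auto split: if_splits)

lemma oriented_graph_dijoin:
  assumes "oriented_graph L" and "oriented_graph R"
  shows "oriented_graph (dijoin L R)"
  using assms unfolding oriented_graph_iff dijoin_def by auto

lemma (in oriented_graph) acyclic_digraph_iff: "acyclic_digraph D \<longleftrightarrow> acyclic (parcs D)"
proof -
  have "(\<exists>p. cycle p) \<longleftrightarrow> (\<exists>u. (u, u) \<in> (parcs D)\<^sup>+)"
  proof
    assume "\<exists>p. cycle p"
    then show "\<exists>u. (u, u) \<in> (parcs D)\<^sup>+"
      unfolding cycle_def using reachable1_awalk by blast
  next
    assume "\<exists>u. (u, u) \<in> (parcs D)\<^sup>+"
    then obtain u p where "awalk u p u" "p \<noteq> []"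
      using reachable1_awalk by blast
    then have "closed_w p"
      unfolding closed_w_def by blast
    then show "\<exists>p. cycle p"
      using closed_w_imp_cycle by blast
  qed
  then show ?thesis
    unfolding acyclic_digraph_def acyclic_def by blast
qed

lemma (in oriented_graph) ex_decycling_family: "\<exists>Xs. decycling_family Xs D"
proof -
  obtain f :: "'a \<Rightarrow> nat" where f: "inj_on f (pverts D)"
    using finite_imp_inj_to_nat_seg pair_finite_verts by metis
  have "\<exists>Xs. (\<forall>X \<in> set Xs. X \<subseteq> pverts H) \<and> acyclic_digraph (fold invert Xs H)"
    if "oriented_graph H" "inj_on f (pverts H)" for H
    using that
  proof (induction "card {(u, v) \<in> parcs H. f v \<le> f u}" arbitrary: H rule: less_induct)
    case less
    interpret H: oriented_graph H by fact
    show ?case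
    proof (cases "\<exists>u v. (u, v) \<in> parcs H \<and> f v \<le> f u")
      case False
      then have "parcs H \<subseteq> measure f"
        by (auto simp: not_le)
      then have "acyclic (parcs H)"
        by (meson acyclic_subset wf_acyclic wf_measure)
      then have "acyclic_digraph (fold invert [] H)"
        by (simp add: H.acyclic_digraph_iff)
      then show ?thesis
        by (intro exI[of _ "[]"]) simp
    next
      case True
      then obtain u v where uv: "(u, v) \<in> parcs H" "f v \<le> f u" by blast
      have inV: "u \<in> pverts H" "v \<in> pverts H" and "u \<noteq> v"
        using uv(1) less.prems(1) unfolding oriented_graph_iff by auto
      then have lt: "f v < f u"
        using uv(2) less.prems(2) by (metis inj_onD le_neq_implies_less)
      let ?H = "invert {u, v} H"
      let ?B = "\<lambda>H. {(u, v) \<in> parcs H. f v \<le> f u}"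
      have sub: "?B ?H \<subseteq> ?B H - {(u, v)}"
        using uv lt less.prems(1) unfolding oriented_graph_iff by (auto split: if_splits)
      have fin: "finite (?B H)"
        by (rule finite_subset[OF _ H.pair_finite_arcs]) auto
      have "?B ?H \<subset> ?B H"
        using sub uv by blast
      then have "card (?B ?H) < card (?B H)"
        by (rule psubset_card_mono[OF fin])
      moreover have "oriented_graph ?H"
        using less.prems(1) by (rule oriented_graph_invert)
      moreover have "inj_on f (pverts ?H)"
        using less.prems(2) by simp
      ultimately obtain Xs where
        "\<forall>X \<in> set Xs. X \<subseteq> pverts ?H" "acyclic_digraph (fold invert Xs ?H)"
        using less.hyps by blast
      then show ?thesis
        using inV by (intro exI[of _ "{u, v} # Xs"]) simp
    qed
  qed
  then show ?thesis
    using f oriented_graph_axioms unfolding decycling_family_def by blast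
qed

end

theory Submission
  imports Defs
begin

text \<open>
  Three inversions label every vertex \<open>v\<close> by a vector \<open>x v\<close> over the two-element field, and an arc
  \<open>uv\<close> is reversed iff the dot product of \<open>x u\<close> and \<open>x v\<close> is 1. Let \<open>A\<close> and \<open>B\<close> be the sets of labels
  occurring in \<open>L\<close> and \<open>R\<close>. Acyclicity of the arcs between \<open>L\<close> and \<open>R\<close> makes the rows of the matrix
  of products \<open>a \<cdot> b\<close> a chain, and the arcs inside \<open>L\<close> follow that chain.

  If distinct labels in \<open>A\<close> have distinct rows, then by rank \<open>A\<close> has at most three elements, or its
  least row belongs to the zero vector, which contradicts strong connectivity; three blocks can be
  decycled by one inversion. Likewise for \<open>B\<close>. Otherwise there are nonzero \<open>c = a + a'\<close>
  orthogonal to \<open>B\<close> and \<open>d = b + b'\<close> orthogonal to \<open>A\<close>, and \<open>c \<cdot> d = 0\<close>. If \<open>d \<cdot> d = 0\<close>, the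
  product has rank one on the complement of \<open>d\<close>, so one inversion decycles \<open>L\<close>; the same holds for
  \<open>c\<close> and \<open>R\<close>. In the remaining case \<open>c, d, e\<close> with \<open>e = c + d + (1, 1, 1)\<close> is an orthonormal basis.
  If all of \<open>B\<close> is orthogonal to \<open>e\<close>, then \<open>B\<close> is contained in \<open>{0, d}\<close>; otherwise the labels in \<open>A\<close>
  orthogonal to \<open>e\<close> precede the others, and inverting the vertices \<open>u\<close> with \<open>x u \<cdot> c = 1\<close> decycles \<open>L\<close>.
\<close>

section \<open>Flipping arcs\<close>

text \<open>\<open>s\<close> is an arbitrary predicate so that several successive inversions become
  one \<open>flip\<close>, with \<open>s u v\<close> the parity of the number of inverted sets
  containing both ends.\<close>

definition flip :: "('a \<Rightarrow> 'a \<Rightarrow> bool) \<Rightarrow> 'a rel \<Rightarrow> 'a rel" where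
  "flip s E = {(u, v). if s u v then (v, u) \<in> E else (u, v) \<in> E}"

lemma flip_iff: "(u, v) \<in> flip s E \<longleftrightarrow> (if s u v then (v, u) \<in> E else (u, v) \<in> E)"
  by (simp add: flip_def)

lemma flip_converse:
  assumes "\<And>u v. s u v = s v u"
  shows "flip s (E\<inverse>) = (flip s E)\<inverse>"
  using assms by (auto simp: flip_iff split: if_splits)

text \<open>Phrased for bare relations so that it applies to converses too, which is how the right
  side is reduced to the left.\<close>

definition one_decyclable :: "'a rel \<Rightarrow> bool" where
  "one_decyclable E \<longleftrightarrow> (\<exists>X. acyclic (flip (\<lambda>u v. u \<in> X \<and> v \<in> X) E))"

lemma one_decyclable_converse: "one_decyclable (E\<inverse>) \<longleftrightarrow> one_decyclable E"
  by (simp add: one_decyclable_def flip_converse conj_commute)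

text \<open>\<open>g\<close> cannot fall along a walk, so a closed walk stays on a single
  level.\<close>

lemma acyclic_if_acyclic_levels:
  fixes g :: "'a \<Rightarrow> nat"
  assumes mono: "\<And>u v. (u, v) \<in> E \<Longrightarrow> g u \<le> g v"
    and level: "\<And>k. acyclic {(u, v) \<in> E. g u = k \<and> g v = k}"
  shows "acyclic E"
proof -
  have "g u \<le> g v \<and> (g u = g v \<longrightarrow> (u, v) \<in> {(p, q) \<in> E. g p = g u \<and> g q = g u}\<^sup>+)"
    if "(u, v) \<in> E\<^sup>+" for u v
    using that
  proof (induction rule: trancl_induct)
    case (base y)
    then show ?case using mono by auto
  next
    case (step y z)
    then have "g y \<le> g z" using mono by blast
    moreover have "(u, z) \<in> {(p, q) \<in> E. g p = g u \<and> g q = g u}\<^sup>+" if "g u = g z"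
    proof -
      have "g y = g u" using that step.IH \<open>g y \<le> g z\<close> by simp
      then have "(u, y) \<in> {(p, q) \<in> E. g p = g u \<and> g q = g u}\<^sup>+"
        and "(y, z) \<in> {(p, q) \<in> E. g p = g u \<and> g q = g u}"
        using step that by auto
      then show ?thesis by (rule trancl_into_trancl)
    qed
    ultimately show ?case using step.IH by auto
  qed
  then show ?thesis using level unfolding acyclic_def by blast
qed

lemma acyclic_if_hom:
  assumes hom: "\<And>u v. (u, v) \<in> E \<Longrightarrow> (h u, h v) \<in> F" and "acyclic F"
  shows "acyclic E"
proof -
  have "(h u, h v) \<in> F\<^sup>+" if "(u, v) \<in> E\<^sup>+" for u v
    using that by (induction rule: trancl_induct) (auto dest: hom intro: trancl_into_trancl)
  then show ?thesis
    using \<open>acyclic F\<close> unfolding acyclic_def by blast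
qed

text \<open>
  A reversed acyclic level stays acyclic, so on each level it suffices that the two flippings
  agree or disagree uniformly.
\<close>

lemma one_decyclable_if_levels:
  fixes g :: "'a \<Rightarrow> nat"
  assumes dom: "E \<subseteq> V \<times> V" and sym: "\<And>u v. s u v = s v u"
    and acyc: "acyclic (flip s E)"
    and same: "\<And>u v. u \<in> V \<Longrightarrow> v \<in> V \<Longrightarrow> g u = g v \<Longrightarrow> (s u v \<noteq> (f u \<and> f v)) = c (g u)"
    and diff: "\<And>u v. (u, v) \<in> flip s E \<Longrightarrow> g u \<noteq> g v \<Longrightarrow> (s u v \<noteq> (f u \<and> f v)) = (g v < g u)"
  shows "one_decyclable E"
proof -
  let ?F = "flip s E" and ?H = "flip (\<lambda>u v. u \<in> Collect f \<and> v \<in> Collect f) E"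
  have H: "(u, v) \<in> ?H \<longleftrightarrow> (if s u v \<noteq> (f u \<and> f v) then (v, u) \<in> ?F else (u, v) \<in> ?F)" for u v
    using sym by (metis flip_iff mem_Collect_eq)
  have inV: "u \<in> V" "v \<in> V" if "(u, v) \<in> ?H" for u v
    using that dom by (auto simp: flip_iff split: if_splits)
  have "acyclic ?H"
  proof (rule acyclic_if_acyclic_levels)
    \<comment> \<open>By \<open>diff\<close>, among the arcs of \<open>?F\<close> between levels
      exactly those along which \<open>g\<close> falls get reversed, so in \<open>?H\<close> they
      all rise.\<close>
    show "g u \<le> g v" if uv: "(u, v) \<in> ?H" for u v
    proof (rule ccontr)
      assume "\<not> g u \<le> g v"
      then have lt: "g v < g u" by simp
      show False
      proof (cases "s u v \<noteq> (f u \<and> f v)")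
        case True
        then have "(v, u) \<in> ?F" using uv H by simp
        then show False using diff[of v u] True lt sym[of v u] by fastforce
      next
        case False
        then have "(u, v) \<in> ?F" using uv H by simp
        then show False using diff[of u v] False lt by fastforce
      qed
    qed
    show "acyclic {(u, v) \<in> ?H. g u = k \<and> g v = k}" for k
    proof -
      have "{(u, v) \<in> ?H. g u = k \<and> g v = k} \<subseteq> (if c k then ?F\<inverse> else ?F)"
      proof clarify
        fix u v
        assume uv: "(u, v) \<in> ?H" "k = g u" "g v = g u"
        then have "(s u v \<noteq> (f u \<and> f v)) = c (g u)"
          using same inV by metis
        then show "(u, v) \<in> (if c (g u) then ?F\<inverse> else ?F)"
          using uv(1) H[of u v] by (cases "c (g u)") simp_all
      qed
      moreover have "acyclic (if c k then ?F\<inverse> else ?F)"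
        using acyc by simp
      ultimately show ?thesis by (rule acyclic_subset[rotated])
    qed
  qed
  then show ?thesis unfolding one_decyclable_def by blast
qed

section \<open>The dot product on three-bit vectors\<close>

type_synonym vec3 = "bool \<times> bool \<times> bool"

fun dot :: "vec3 \<Rightarrow> vec3 \<Rightarrow> bool" where
  "dot (a, b, c) (a', b', c') = ((a \<and> a') \<noteq> ((b \<and> b') \<noteq> (c \<and> c')))"

fun vadd :: "vec3 \<Rightarrow> vec3 \<Rightarrow> vec3" where
  "vadd (a, b, c) (a', b', c') = (a \<noteq> a', b \<noteq> b', c \<noteq> c')"

abbreviation vzero :: vec3 where "vzero \<equiv> (False, False, False)"
abbreviation vone :: vec3 where "vone \<equiv> (True, True, True)"

lemma dot_commute: "dot a b = dot b a"
  by (cases a; cases b) auto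

lemma dot_vzero [simp]: "\<not> dot vzero a"
  by (cases a) auto

lemma dot_vadd_left: "dot (vadd a a') b = (dot a b \<noteq> dot a' b)"
  by (cases a; cases a'; cases b) auto

lemma dot_vadd_right: "dot b (vadd a a') = (dot b a \<noteq> dot b a')"
  by (metis dot_commute dot_vadd_left)

lemma vadd_eq_vzero_iff: "vadd a b = vzero \<longleftrightarrow> a = b"
  by (cases a; cases b) auto

lemma vadd_commute: "vadd a b = vadd b a"
  by (cases a; cases b) auto

text \<open>A nonzero isotropic \<open>d\<close> has exactly two ones, and
  \<open>vadd d vone\<close> is the unit vector at its zero coordinate. In a vector orthogonal to
  \<open>d\<close> the other two coordinates agree, so their contributions to the product
  cancel.\<close>

lemma dot_on_isotropic_perp:
  assumes "d \<noteq> vzero" "\<not> dot d d" "\<not> dot a d" "\<not> dot b d"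
  shows "dot a b \<longleftrightarrow> dot a (vadd d vone) \<and> dot b (vadd d vone)"
  using assms
  by (cases a; cases b; cases d) (simp only: dot.simps vadd.simps prod.inject, argo)

text \<open>Since \<open>dot v v = dot v vone\<close>, the vectors \<open>c\<close>,
  \<open>d\<close>, \<open>e\<close> form an orthonormal basis; the product is expanded in it, the
  \<open>d\<close> coordinates being zero.\<close>

lemma dot_on_anisotropic_perp:
  assumes "dot c c" "dot d d" "\<not> dot c d" "\<not> dot a d" "\<not> dot b d"
  defines "e \<equiv> vadd vone (vadd c d)"
  shows "dot a b \<longleftrightarrow> (dot a c \<and> dot b c) \<noteq> (dot a e \<and> dot b e)"
  using assms(1-5) unfolding e_def
  by (cases a; cases b; cases c; cases d) (simp only: dot.simps vadd.simps prod.inject, argo)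

text \<open>With \<open>e = vadd vone (vadd c d)\<close> completing the orthonormal basis,
  \<open>b\<close> is \<open>e\<close> or \<open>vadd d e\<close>, and \<open>a\<close> has
  \<open>d\<close> coordinate zero.\<close>

lemma dot_eq_if_perp:
  assumes "dot c c" "dot d d" "\<not> dot c d" "\<not> dot a d" "\<not> dot b c"
    and "dot b (vadd vone (vadd c d))"
  shows "dot a b = dot a (vadd vone (vadd c d))"
  using assms
  by (cases a; cases b; cases c; cases d) (simp only: dot.simps vadd.simps prod.inject, argo)

text \<open>The triangular pattern makes \<open>b1\<close>, \<open>b2\<close>, \<open>b3\<close> a
  basis, and only zero is orthogonal to a basis.\<close>

lemma vzero_if_triangular:
  assumes "\<not> dot a0 b1" "\<not> dot a0 b2" "\<not> dot a0 b3"
    and "dot a1 b1" "\<not> dot a1 b2" "\<not> dot a1 b3"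
    and "dot a2 b1" "dot a2 b2" "\<not> dot a2 b3"
    and "dot a3 b1" "dot a3 b2" "dot a3 b3"
  shows "a0 = vzero"
proof -
  \<comment> \<open>Over the two-element field, these facts together with
    \<open>vadd b1 b2 \<noteq> b3\<close> amount to linear independence.\<close>
  have "b1 \<noteq> vzero" "b2 \<noteq> vzero" "b3 \<noteq> vzero" "b1 \<noteq> b2" "b1 \<noteq> b3" "b2 \<noteq> b3"
    using assms by (auto simp: dot_commute[of _ vzero])
  moreover have "vadd b1 b2 \<noteq> b3"
    using assms dot_vadd_right[of a3 b1 b2] by auto
  ultimately show ?thesis
    using assms(1-3)
    by (cases a0; cases b1; cases b2; cases b3) (simp only: dot.simps vadd.simps prod.inject, argo)
qed

section \<open>Decycling one side\<close>

lemma one_decyclable_if_rank_one: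
  assumes dom: "E \<subseteq> V \<times> V" and acyc: "acyclic (flip s E)"
    and rank1: "\<And>u v. u \<in> V \<Longrightarrow> v \<in> V \<Longrightarrow> s u v \<longleftrightarrow> f u \<and> f v"
  shows "one_decyclable E"
proof -
  have "(u, v) \<in> flip s E \<longleftrightarrow> (u, v) \<in> flip (\<lambda>u v. u \<in> Collect f \<and> v \<in> Collect f) E" for u v
  proof (cases "u \<in> V \<and> v \<in> V")
    case True
    then show ?thesis by (simp add: flip_iff rank1)
  next
    case False
    then have "(u, v) \<notin> E" "(v, u) \<notin> E" using dom by auto
    then show ?thesis by (simp add: flip_iff)
  qed
  then have "flip s E = flip (\<lambda>u v. u \<in> Collect f \<and> v \<in> Collect f) E" by auto
  then show ?thesis
    using acyc unfolding one_decyclable_def by metis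
qed

text \<open>
  A tournament on the blocks \<open>0, 1, 2\<close> is either transitive or becomes transitive by reversing the
  arc between \<open>0\<close> and \<open>2\<close>; \<open>g\<close> is the in-degree after that.
\<close>

lemma three_blocks_reorder:
  fixes p :: "nat \<Rightarrow> nat \<Rightarrow> bool"
  shows "\<exists>f (g :: nat \<Rightarrow> nat). \<forall>j<3. \<forall>i<j. g i \<noteq> g j \<and> (p i j \<noteq> (f i \<and> f j)) = (g j < g i)"
proof -
  \<comment> \<open>For \<open>i < j\<close>, \<open>p i j\<close> means that the arc points from
    \<open>j\<close> to \<open>i\<close>; \<open>cyc\<close> says that the three arcs form a
    directed triangle.\<close>
  define cyc where "cyc \<longleftrightarrow> p 0 1 = p 1 2 \<and> p 0 2 \<noteq> p 0 1"
  define q where "q = (p 0 2 \<noteq> cyc)"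
  define f where "f = (\<lambda>i::nat. cyc \<and> i \<noteq> 1)"
  define g :: "nat \<Rightarrow> nat" where
    "g = (\<lambda>i. if i = 0 then of_bool (p 0 1) + of_bool q
              else if i = 1 then of_bool (\<not> p 0 1) + of_bool (p 1 2)
              else of_bool (\<not> q) + of_bool (\<not> p 1 2))"
  let ?P = "\<lambda>i j. g i \<noteq> g j \<and> (p i j \<noteq> (f i \<and> f j)) = (g j < g i)"
  have P: "?P 0 1" "?P 0 2" "?P 1 2"
    unfolding f_def g_def q_def cyc_def
    by (cases "p 0 1"; cases "p 0 2"; cases "p 1 2"; simp)+
  have "?P i j" if "j < 3" "i < j" for i j
  proof -
    have "i = 0 \<and> j = 1 \<or> i = 0 \<and> j = 2 \<or> i = 1 \<and> j = 2"
      using that by linarith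
    then show ?thesis using P by metis
  qed
  then show ?thesis by blast
qed

text \<open>\<open>B\<close> stands for the labels of the other side. The rows form a chain, and
  ranking the labels along it numbers the blocks. Up to three blocks are reordered by one inversion;
  a fourth forces the lowest label to be zero, as the space has dimension three.\<close>

lemma one_decyclable_if_inj_rows:
  fixes x :: "'a \<Rightarrow> vec3" and V :: "'a set" and B :: "vec3 set"
  defines "F \<equiv> \<lambda>E. flip (\<lambda>u v. dot (x u) (x v)) E"
  assumes dom: "E \<subseteq> V \<times> V" and strong: "\<And>u v. u \<in> V \<Longrightarrow> v \<in> V \<Longrightarrow> (u, v) \<in> E\<^sup>*"
    and acyc: "acyclic (F E)"
    and fwd: "\<And>u u' b. u \<in> V \<Longrightarrow> u' \<in> V \<Longrightarrow> b \<in> B \<Longrightarrow> \<not> dot (x u) b \<Longrightarrow> dot (x u') b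
      \<Longrightarrow> (u', u) \<notin> F E"
    and chain: "\<And>u u' b b'. u \<in> V \<Longrightarrow> u' \<in> V \<Longrightarrow> b \<in> B \<Longrightarrow> b' \<in> B
      \<Longrightarrow> \<not> dot (x u) b \<Longrightarrow> dot (x u') b \<Longrightarrow> dot (x u) b' \<Longrightarrow> dot (x u') b'"
    and inj: "\<And>u u'. u \<in> V \<Longrightarrow> u' \<in> V \<Longrightarrow> (\<And>b. b \<in> B \<Longrightarrow> dot (x u) b = dot (x u') b)
      \<Longrightarrow> x u = x u'"
  shows "one_decyclable E"
proof -
  define S where "S a = {b \<in> B. dot a b}" for a
  define A where "A = x ` V"
  define rk where "rk a = card {a' \<in> A. S a' \<subset> S a}" for a
  have finA: "finite A" by simp
  have total: "S a \<subset> S a' \<or> S a' \<subset> S a" if a: "a \<in> A" "a' \<in> A" "a \<noteq> a'" for a a'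
  proof -
    obtain u u' where u: "u \<in> V" "u' \<in> V" "a = x u" "a' = x u'"
      using a unfolding A_def by blast
    have "S a \<noteq> S a'"
      using inj[OF u(1,2)] u(3,4) a(3) unfolding S_def by blast
    moreover have "S a \<subseteq> S a' \<or> S a' \<subseteq> S a"
      using chain[OF u(2,1)] u(3,4) unfolding S_def by blast
    ultimately show ?thesis by blast
  qed
  have rk_mono: "rk a < rk a'" if "a \<in> A" "S a \<subset> S a'" for a a'
    unfolding rk_def using that by (intro psubset_card_mono) auto
  have rk_less: "S a \<subset> S a'" if "a \<in> A" "a' \<in> A" "rk a < rk a'" for a a'
    using total[of a a'] rk_mono[of a' a] that by fastforce
  have rk_inj: "inj_on rk A"
    using total rk_mono by (metis inj_onI less_irrefl)
  have rk_lt: "rk a < card A" if "a \<in> A" for a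
    unfolding rk_def using that by (intro psubset_card_mono[OF finA]) auto
  have rk_surj: "rk ` A = {..<card A}"
    using rk_lt by (intro card_subset_eq) (auto simp: card_image[OF rk_inj])
  have fwd': "S (x v) \<subset> S (x u) \<Longrightarrow> (u, v) \<notin> F E" if "u \<in> V" "v \<in> V" for u v
    using fwd[OF that(2,1)] unfolding S_def by blast
  show ?thesis
  proof (cases "card A \<le> 3")
    case True
    define a where "a = the_inv_into A rk"
    have a: "a (rk (x u)) = x u" if "u \<in> V" for u
      using that unfolding a_def A_def by (simp add: the_inv_into_f_f rk_inj[unfolded A_def])
    obtain f and g :: "nat \<Rightarrow> nat" where fg:
      "\<And>i j. j < 3 \<Longrightarrow> i < j \<Longrightarrow> g i \<noteq> g j"
      "\<And>i j. j < 3 \<Longrightarrow> i < j \<Longrightarrow> (dot (a i) (a j) \<noteq> (f i \<and> f j)) = (g j < g i)"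
      using three_blocks_reorder[of "\<lambda>i j. dot (a i) (a j)"] by blast
    have lt3: "rk (x u) < 3" if "u \<in> V" for u
      using rk_lt[of "x u"] True that unfolding A_def by simp
    let ?g = "\<lambda>u. g (rk (x u))" and ?f = "\<lambda>u. f (rk (x u))"
    have g_inj: "x u = x v" if "u \<in> V" "v \<in> V" "?g u = ?g v" for u v
    proof -
      have "rk (x u) = rk (x v)"
        using fg(1)[OF lt3[OF that(1)], of "rk (x v)"] fg(1)[OF lt3[OF that(2)], of "rk (x u)"] that(3)
        by (metis linorder_neqE_nat)
      then show ?thesis using a that(1,2) by metis
    qed
    \<comment> \<open>Vertices on one level share their label, so disagreement is constant there and
      can be read off any of them.\<close>
    let ?c = "\<lambda>k. \<exists>w\<in>V. ?g w = k \<and> dot (x w) (x w) \<noteq> ?f w"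
    show ?thesis
    proof (rule one_decyclable_if_levels[where g = ?g and f = ?f and c = ?c])
      show "E \<subseteq> V \<times> V" by (rule dom)
      show "dot (x u) (x v) = dot (x v) (x u)" for u v by (rule dot_commute)
      show "acyclic (flip (\<lambda>u v. dot (x u) (x v)) E)" using acyc unfolding F_def .
    next
      fix u v assume uv: "u \<in> V" "v \<in> V" "?g u = ?g v"
      have "x v = x u" using g_inj[OF uv] by simp
      moreover have "?c (?g u) \<longleftrightarrow> dot (x u) (x u) \<noteq> ?f u"
        using g_inj uv(1) by metis
      ultimately show "(dot (x u) (x v) \<noteq> (?f u \<and> ?f v)) = ?c (?g u)" by simp
    next
      fix u v assume uv: "(u, v) \<in> flip (\<lambda>u v. dot (x u) (x v)) E" "?g u \<noteq> ?g v"
      then have V: "u \<in> V" "v \<in> V" using dom by (auto simp: flip_iff split: if_splits)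
      have "\<not> rk (x v) < rk (x u)"
        using fwd'[OF V] rk_less uv(1) V unfolding A_def F_def by blast
      moreover have "rk (x u) \<noteq> rk (x v)" using uv(2) by metis
      ultimately have "rk (x u) < rk (x v)" by simp
      from fg(2)[OF lt3[OF V(2)] this]
      show "(dot (x u) (x v) \<noteq> (?f u \<and> ?f v)) = (?g v < ?g u)"
        by (simp add: a V)
    qed
  next
    case False
    have rk_ex: "\<exists>a. a \<in> A \<and> rk a = i" if "i < 4" for i
    proof -
      have "i \<in> rk ` A" unfolding rk_surj using that False by simp
      then show ?thesis by blast
    qed
    obtain a0 a1 a2 a3 where aA: "a0 \<in> A" "a1 \<in> A" "a2 \<in> A" "a3 \<in> A"
      and rks: "rk a0 = 0" "rk a1 = 1" "rk a2 = 2" "rk a3 = 3"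
      using rk_ex[of 0] rk_ex[of 1] rk_ex[of 2] rk_ex[of 3] by auto
    have sub: "S a0 \<subset> S a1" "S a1 \<subset> S a2" "S a2 \<subset> S a3"
      using rk_less aA rks by simp_all
    \<comment> \<open>Each \<open>b\<close> enters at one step of the chain and stays in all larger
      rows, which yields the triangular pattern.\<close>
    obtain b1 b2 b3 where "b1 \<in> S a1 - S a0" "b2 \<in> S a2 - S a1" "b3 \<in> S a3 - S a2"
      using sub by blast
    then have "a0 = vzero"
      using sub unfolding S_def
      by (intro vzero_if_triangular[of a0 b1 b2 b3 a1 a2 a3]) blast+
    \<comment> \<open>No arc leaves the nonzero labels, against strong connectivity.\<close>
    have into: "x u = vzero" if "(u, v) \<in> E" "x v = vzero" for u v
    proof (rule ccontr)
      assume "x u \<noteq> vzero"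
      have V: "u \<in> V" "v \<in> V" using that dom by auto
      have "rk (x u) \<noteq> 0"
        using rk_inj rks(1) aA(1) \<open>a0 = vzero\<close> \<open>x u \<noteq> vzero\<close> V unfolding A_def
        by (metis imageI inj_onD)
      then have "S (x v) \<subset> S (x u)"
        using rk_less[of a0 "x u"] rks(1) aA(1) \<open>a0 = vzero\<close> that(2) V unfolding A_def by simp
      \<comment> \<open>An arc with an end labelled zero is not reversed.\<close>
      moreover have "(u, v) \<in> F E"
        using that unfolding F_def by (simp add: flip_iff dot_commute[of _ vzero])
      ultimately show False using fwd'[OF V] by blast
    qed
    obtain u v where uv: "u \<in> V" "v \<in> V" "x u = a1" "x v = a0"
      using aA unfolding A_def by blast
    have "(u, v) \<in> E\<^sup>*" using strong uv by blast
    then have "x u = vzero"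
      by (induction rule: converse_rtrancl_induct) (use uv \<open>a0 = vzero\<close> into in auto)
    then show ?thesis using uv \<open>a0 = vzero\<close> rks by simp
  qed
qed

text \<open>A product of 1 between a left and a right label means that the arc now points from right
  to left. So \<open>fwd1\<close> and \<open>fwd2\<close> exclude directed triangles across the two
  sides, and \<open>chain\<close> excludes directed 4-cycles.\<close>

lemma one_side_decyclable:
  fixes x :: "'a \<Rightarrow> vec3" and y :: "'b \<Rightarrow> vec3"
  defines "F1 \<equiv> flip (\<lambda>u v. dot (x u) (x v))" and "F2 \<equiv> flip (\<lambda>u v. dot (y u) (y v))"
  assumes dom1: "E1 \<subseteq> V1 \<times> V1" and dom2: "E2 \<subseteq> V2 \<times> V2"
    and strong1: "\<And>u v. u \<in> V1 \<Longrightarrow> v \<in> V1 \<Longrightarrow> (u, v) \<in> E1\<^sup>*"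
    and strong2: "\<And>u v. u \<in> V2 \<Longrightarrow> v \<in> V2 \<Longrightarrow> (u, v) \<in> E2\<^sup>*"
    and acyc1: "acyclic (F1 E1)" and acyc2: "acyclic (F2 E2)"
    and fwd1: "\<And>u u' w. u \<in> V1 \<Longrightarrow> u' \<in> V1 \<Longrightarrow> w \<in> V2
      \<Longrightarrow> \<not> dot (x u) (y w) \<Longrightarrow> dot (x u') (y w) \<Longrightarrow> (u', u) \<notin> F1 E1"
    and fwd2: "\<And>u w w'. u \<in> V1 \<Longrightarrow> w \<in> V2 \<Longrightarrow> w' \<in> V2
      \<Longrightarrow> \<not> dot (x u) (y w) \<Longrightarrow> dot (x u) (y w') \<Longrightarrow> (w, w') \<notin> F2 E2"
    and chain: "\<And>u u' w w'. u \<in> V1 \<Longrightarrow> u' \<in> V1 \<Longrightarrow> w \<in> V2 \<Longrightarrow> w' \<in> V2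
      \<Longrightarrow> \<not> dot (x u) (y w) \<Longrightarrow> dot (x u') (y w) \<Longrightarrow> dot (x u) (y w') \<Longrightarrow> dot (x u') (y w')"
  shows "one_decyclable E1 \<or> one_decyclable E2"
proof (rule ccontr)
  assume "\<not> ?thesis"
  then have n1: "\<not> one_decyclable E1" and n2: "\<not> one_decyclable E2" by auto
  have "\<exists>u\<in>V1. \<exists>u'\<in>V1. x u \<noteq> x u' \<and> (\<forall>w\<in>V2. dot (x u) (y w) = dot (x u') (y w))"
  proof (rule ccontr)
    assume *: "\<not> ?thesis"
    have "one_decyclable E1"
    proof (rule one_decyclable_if_inj_rows[where x = x and V = V1 and B = "y ` V2"])
      show "acyclic (flip (\<lambda>u v. dot (x u) (x v)) E1)" using acyc1 unfolding F1_def .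
      show "(u', u) \<notin> flip (\<lambda>u v. dot (x u) (x v)) E1"
        if "u \<in> V1" "u' \<in> V1" "b \<in> y ` V2" "\<not> dot (x u) b" "dot (x u') b" for u u' b
        using that fwd1 unfolding F1_def by blast
      show "dot (x u') b'" if "u \<in> V1" "u' \<in> V1" "b \<in> y ` V2" "b' \<in> y ` V2"
          "\<not> dot (x u) b" "dot (x u') b" "dot (x u) b'" for u u' b b'
        using that chain by blast
      show "x u = x u'" if "u \<in> V1" "u' \<in> V1" "\<And>b. b \<in> y ` V2 \<Longrightarrow> dot (x u) b = dot (x u') b" for u u'
        using that * by (metis imageI)
    qed (use dom1 strong1 in simp_all)
    then show False using n1 by simp
  qed
  then obtain u u' where u: "u \<in> V1" "u' \<in> V1" "x u \<noteq> x u'"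
    "\<And>w. w \<in> V2 \<Longrightarrow> dot (x u) (y w) = dot (x u') (y w)"
    by blast
  have "\<exists>w\<in>V2. \<exists>w'\<in>V2. y w \<noteq> y w' \<and> (\<forall>u\<in>V1. dot (x u) (y w) = dot (x u) (y w'))"
  proof (rule ccontr)
    assume *: "\<not> ?thesis"
    \<comment> \<open>Between different columns, right arcs run from the larger to the smaller one,
      opposite to the left side; the converse restores the direction.\<close>
    have conv: "flip (\<lambda>u v. dot (y u) (y v)) (E2\<inverse>) = (F2 E2)\<inverse>"
      unfolding F2_def by (rule flip_converse) (rule dot_commute)
    have "one_decyclable (E2\<inverse>)"
    proof (rule one_decyclable_if_inj_rows[where x = y and V = V2 and B = "x ` V1"])
      show "acyclic (flip (\<lambda>u v. dot (y u) (y v)) (E2\<inverse>))" unfolding conv using acyc2 by simp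
      show "(w', w) \<notin> flip (\<lambda>u v. dot (y u) (y v)) (E2\<inverse>)"
        if "w \<in> V2" "w' \<in> V2" "b \<in> x ` V1" "\<not> dot (y w) b" "dot (y w') b" for w w' b
        using that fwd2[of _ w w'] unfolding conv by (auto simp: dot_commute[of "y _"])
      show "dot (y w') b'" if "w \<in> V2" "w' \<in> V2" "b \<in> x ` V1" "b' \<in> x ` V1"
          "\<not> dot (y w) b" "dot (y w') b" "dot (y w) b'" for w w' b b'
        using that chain[of _ _ w w'] by (auto simp: dot_commute[of "y _"])
      show "y w = y w'" if "w \<in> V2" "w' \<in> V2" "\<And>b. b \<in> x ` V1 \<Longrightarrow> dot (y w) b = dot (y w') b" for w w'
        using that * by (metis dot_commute imageI)
      show "(v, w) \<in> (E2\<inverse>)\<^sup>*" if "v \<in> V2" "w \<in> V2" for v w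
        using strong2[OF that(2,1)] by (simp add: rtrancl_converse)
    qed (use dom2 in blast)
    then show False using n2 by (simp add: one_decyclable_converse)
  qed
  then obtain w w' where w: "w \<in> V2" "w' \<in> V2" "y w \<noteq> y w'"
    "\<And>u. u \<in> V1 \<Longrightarrow> dot (x u) (y w) = dot (x u) (y w')"
    by blast
  define c where "c = vadd (x u) (x u')"
  define d where "d = vadd (y w) (y w')"
  have nz: "c \<noteq> vzero" "d \<noteq> vzero"
    using u(3) w(3) unfolding c_def d_def by (simp_all add: vadd_eq_vzero_iff)
  have perp1: "\<not> dot (x v) d" if "v \<in> V1" for v
    using w(4)[OF that] unfolding d_def by (simp add: dot_vadd_right)
  have perp2: "\<not> dot (y v) c" if "v \<in> V2" for v
    using u(4)[OF that] unfolding c_def by (simp add: dot_vadd_right dot_commute[of "y v"])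
  have cd: "\<not> dot c d"
    using perp1 u(1,2) unfolding c_def by (simp add: dot_vadd_left)
  have "dot d d"
  proof (rule ccontr)
    assume "\<not> dot d d"
    then have "one_decyclable E1"
      by (intro one_decyclable_if_rank_one[OF dom1 acyc1[unfolded F1_def],
            where f = "\<lambda>u. dot (x u) (vadd d vone)"]
          dot_on_isotropic_perp[OF nz(2)] perp1)
    then show False using n1 by simp
  qed
  have "dot c c"
  proof (rule ccontr)
    assume "\<not> dot c c"
    then have "one_decyclable E2"
      by (intro one_decyclable_if_rank_one[OF dom2 acyc2[unfolded F2_def],
            where f = "\<lambda>u. dot (y u) (vadd c vone)"]
          dot_on_isotropic_perp[OF nz(1)] perp2)
    then show False using n2 by simp
  qed
  define e where "e = vadd vone (vadd c d)"
  have form1: "dot (x u) (x v) \<longleftrightarrow> (dot (x u) c \<and> dot (x v) c) \<noteq> (dot (x u) e \<and> dot (x v) e)"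
    if "u \<in> V1" "v \<in> V1" for u v
    unfolding e_def
    by (rule dot_on_anisotropic_perp[OF \<open>dot c c\<close> \<open>dot d d\<close> cd perp1[OF that(1)] perp1[OF that(2)]])
  have form2: "dot (y u) (y v) \<longleftrightarrow> (dot (y u) d \<and> dot (y v) d) \<noteq> (dot (y u) e \<and> dot (y v) e)"
    if "u \<in> V2" "v \<in> V2" for u v
    unfolding e_def vadd_commute[of c d]
    by (rule dot_on_anisotropic_perp[OF \<open>dot d d\<close> \<open>dot c c\<close> _ perp2[OF that(1)] perp2[OF that(2)]])
      (simp add: cd dot_commute[of d c])
  show False
  proof (cases "\<exists>w\<in>V2. dot (y w) e")
    case False
    then have "dot (y u) (y v) \<longleftrightarrow> dot (y u) d \<and> dot (y v) d" if "u \<in> V2" "v \<in> V2" for u v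
      using form2 that by blast
    then have "one_decyclable E2"
      using one_decyclable_if_rank_one[OF dom2 acyc2[unfolded F2_def], of "\<lambda>u. dot (y u) d"] by blast
    then show False using n2 by simp
  next
    case True
    then obtain z where z: "z \<in> V2" "dot (y z) e" by blast
    \<comment> \<open>Multiplying by \<open>y z\<close> reads off the \<open>e\<close> coordinate of
      a left label.\<close>
    have xz: "dot (x v) (y z) = dot (x v) e" if "v \<in> V1" for v
      using dot_eq_if_perp[OF \<open>dot c c\<close> \<open>dot d d\<close> cd perp1[OF that] perp2[OF z(1)]] z(2)
      unfolding e_def by blast
    have "one_decyclable E1"
    \<comment> \<open>By \<open>form1\<close>, inverting along the \<open>c\<close> coordinate
      differs from the given flip exactly when both \<open>e\<close> coordinates are 1, that is, on
      all of level 1 and nowhere else.\<close>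
    proof (rule one_decyclable_if_levels[where g = "\<lambda>u. of_bool (dot (x u) e)"
          and f = "\<lambda>u. dot (x u) c" and c = "\<lambda>k. k = 1"])
      show "E1 \<subseteq> V1 \<times> V1" by (rule dom1)
      show "dot (x u) (x v) = dot (x v) (x u)" for u v by (rule dot_commute)
      show "acyclic (flip (\<lambda>u v. dot (x u) (x v)) E1)" using acyc1 unfolding F1_def .
    next
      fix u v assume "u \<in> V1" "v \<in> V1" "of_bool (dot (x u) e) = (of_bool (dot (x v) e) :: nat)"
      then show "(dot (x u) (x v) \<noteq> (dot (x u) c \<and> dot (x v) c)) = (of_bool (dot (x u) e) = (1 :: nat))"
        using form1[of u v] by auto
    next
      fix u v assume uv: "(u, v) \<in> flip (\<lambda>u v. dot (x u) (x v)) E1"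
        "of_bool (dot (x u) e) \<noteq> (of_bool (dot (x v) e) :: nat)"
      then have V: "u \<in> V1" "v \<in> V1" using dom1 by (auto simp: flip_iff split: if_splits)
      \<comment> \<open>The vertex \<open>z\<close> separates the two levels, so an arc falling from
        level 1 to level 0 would violate \<open>fwd1\<close>.\<close>
      have "\<not> dot (x u) e \<and> dot (x v) e"
        using fwd1[OF V(2,1) z(1)] uv V
        by (cases "dot (x u) e"; cases "dot (x v) e") (simp_all add: xz F1_def)
      then show "(dot (x u) (x v) \<noteq> (dot (x u) c \<and> dot (x v) c))
          = (of_bool (dot (x v) e) < (of_bool (dot (x u) e) :: nat))"
        using form1[OF V] by auto
    qed
    then show False using n1 by simp
  qed
qed

section \<open>Inversion numbers\<close>

lemma not_one_decyclable_if_inversion_number_ge_2: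
  assumes D: "oriented_graph D" and inv: "inversion_number D \<ge> 2"
  shows "\<not> one_decyclable (parcs D)"
proof
  assume "one_decyclable (parcs D)"
  then obtain X where X: "acyclic (flip (\<lambda>u v. u \<in> X \<and> v \<in> X) (parcs D))"
    unfolding one_decyclable_def by blast
  \<comment> \<open>\<open>decycling_family\<close> admits only vertex sets; the intersection
    changes no arc, as ends of arcs are vertices.\<close>
  let ?X = "X \<inter> pverts D"
  have "parcs (invert ?X D) \<subseteq> flip (\<lambda>u v. u \<in> X \<and> v \<in> X) (parcs D)"
    using D unfolding oriented_graph_iff by (auto simp: flip_iff split: if_splits)
  then have "acyclic (parcs (invert ?X D))"
    using X by (rule acyclic_subset[rotated])
  then have "decycling_family [?X] D"
    using oriented_graph.acyclic_digraph_iff[OF oriented_graph_invert[OF D]]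
    unfolding decycling_family_def by simp
  then have "inversion_number D \<le> 1"
    unfolding inversion_number_def by (intro Least_le exI[of _ "[?X]"]) simp
  then show False using inv by simp
qed

lemma strongly_connected_rtrancl:
  assumes D: "oriented_graph D" and strong: "strongly_connected (with_proj D)"
    and uv: "u \<in> pverts D" "v \<in> pverts D"
  shows "(u, v) \<in> (parcs D)\<^sup>*"
proof -
  interpret oriented_graph D by (rule D)
  have "u \<rightarrow>\<^sup>*\<^bsub>with_proj D\<^esub> v"
    using strong uv by (auto simp: strongly_connected_def)
  then show ?thesis
    unfolding reachable_def by (auto dest: rtrancl_on_rtranclI)
qed

lemma invert_empty: "invert {} D = D"
  by (simp add: invert_def)

text \<open>The label of a vertex records its membership in the three inverted sets; the dot product
  is then the parity of the number of sets containing both ends.\<close>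

lemma three_labels_if_inversion_number_less_4:
  assumes D: "oriented_graph D" and inv: "inversion_number D < 4"
  obtains x :: "'a \<Rightarrow> vec3" where "acyclic (flip (\<lambda>u v. dot (x u) (x v)) (parcs D))"
proof -
  have "\<exists>k Xs. length Xs = k \<and> decycling_family Xs D"
    using oriented_graph.ex_decycling_family[OF D] by blast
  from LeastI_ex[OF this] obtain Xs where
    Xs: "length Xs = inversion_number D" "decycling_family Xs D"
    unfolding inversion_number_def by blast
  \<comment> \<open>Inverting the empty set changes nothing, so a shorter optimal family can be
    padded to length exactly three.\<close>
  define Ys where "Ys = Xs @ replicate (3 - length Xs) {}"
  have pad: "fold invert (replicate n {}) H = H" for n and H :: "'a pair_pre_digraph"
    by (induction n) (simp_all add: invert_empty)
  have "length Ys = 3" using Xs(1) inv unfolding Ys_def by simp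
  then obtain X Y Z where Ys: "Ys = [X, Y, Z]"
    by (auto simp: length_Suc_conv numeral_3_eq_3)
  let ?H = "invert Z (invert Y (invert X D))"
  have "acyclic_digraph (fold invert Ys D)"
    using Xs(2) unfolding Ys_def decycling_family_def fold_append comp_def pad by blast
  then have "acyclic (parcs ?H)"
    using oriented_graph.acyclic_digraph_iff[of ?H] D unfolding Ys
    by (simp add: oriented_graph_invert)
  moreover have "parcs ?H = flip (\<lambda>u v. dot (u \<in> X, u \<in> Y, u \<in> Z) (v \<in> X, v \<in> Y, v \<in> Z)) (parcs D)"
    by (auto simp: flip_iff split: if_splits)
  ultimately show thesis
    using that[of "\<lambda>u. (u \<in> X, u \<in> Y, u \<in> Z)"] by argo
qed

theorem theorem3p6:
  fixes L :: "'a pair_pre_digraph" and R :: "'b pair_pre_digraph"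
  assumes "oriented_graph L" and "oriented_graph R"
    and "strongly_connected (with_proj L)" and "strongly_connected (with_proj R)"
    and "inversion_number L \<ge> 2" and "inversion_number R \<ge> 2"
  shows "inversion_number (dijoin L R) \<ge> 4"
proof (rule ccontr)
  assume "\<not> inversion_number (dijoin L R) \<ge> 4"
  then obtain x :: "'a + 'b \<Rightarrow> vec3"
    where acyc: "acyclic (flip (\<lambda>u v. dot (x u) (x v)) (parcs (dijoin L R)))"
    using three_labels_if_inversion_number_less_4[OF oriented_graph_dijoin[OF assms(1,2)]]
    by (metis not_le)
  define F where "F = flip (\<lambda>u v. dot (x u) (x v)) (parcs (dijoin L R))"
  let ?FL = "flip (\<lambda>u v. dot (x (Inl u)) (x (Inl v))) (parcs L)"
    and ?FR = "flip (\<lambda>u v. dot (x (Inr u)) (x (Inr v))) (parcs R)"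
  have FL: "(Inl u, Inl v) \<in> F" if "(u, v) \<in> ?FL" for u v
    using that by (auto simp: F_def flip_iff dijoin_def split: if_splits)
  have FR: "(Inr u, Inr v) \<in> F" if "(u, v) \<in> ?FR" for u v
    using that by (auto simp: F_def flip_iff dijoin_def split: if_splits)
  have LR: "(Inl u, Inr w) \<in> F" if "u \<in> pverts L" "w \<in> pverts R" "\<not> dot (x (Inl u)) (x (Inr w))" for u w
    using that by (auto simp: F_def flip_iff dijoin_def)
  have RL: "(Inr w, Inl u) \<in> F" if "u \<in> pverts L" "w \<in> pverts R" "dot (x (Inl u)) (x (Inr w))" for u w
    using that by (auto simp: F_def flip_iff dijoin_def dot_commute[of "x (Inr w)"])
  have irrefl: "(p, p) \<notin> F\<^sup>+" for p
    using acyc unfolding F_def acyclic_def by blast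
  have acycL: "acyclic ?FL" and acycR: "acyclic ?FR"
    using acyclic_if_hom[where h = Inl, OF FL] acyclic_if_hom[where h = Inr, OF FR] acyc[folded F_def]
    by simp_all
  \<comment> \<open>\<open>no3\<close> will exclude the triangles \<open>u, w, u'\<close> and
    \<open>w', u, w\<close>, and \<open>no4\<close> the 4-cycle \<open>u, w, u', w'\<close>, with
    \<open>u, u'\<close> on the left and \<open>w, w'\<close> on the right.\<close>
  have no3: False if "(p, q) \<in> F" "(q, r) \<in> F" "(r, p) \<in> F" for p q r
    using that irrefl by (meson trancl.intros)
  have no4: False if "(p, q) \<in> F" "(q, r) \<in> F" "(r, t) \<in> F" "(t, p) \<in> F" for p q r t
    using that irrefl by (meson trancl.intros)
  have "one_decyclable (parcs L) \<or> one_decyclable (parcs R)"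
  proof (rule one_side_decyclable[where x = "\<lambda>u. x (Inl u)" and y = "\<lambda>w. x (Inr w)"
        and ?V1.0 = "pverts L" and ?V2.0 = "pverts R"])
    show "parcs L \<subseteq> pverts L \<times> pverts L" "parcs R \<subseteq> pverts R \<times> pverts R"
      using assms(1,2) unfolding oriented_graph_iff by simp_all
    show "(u, v) \<in> (parcs L)\<^sup>*" if "u \<in> pverts L" "v \<in> pverts L" for u v
      by (rule strongly_connected_rtrancl[OF assms(1,3) that])
    show "(u, v) \<in> (parcs R)\<^sup>*" if "u \<in> pverts R" "v \<in> pverts R" for u v
      by (rule strongly_connected_rtrancl[OF assms(2,4) that])
    show "acyclic ?FL" "acyclic ?FR" by (fact acycL acycR)+
    show "(u', u) \<notin> ?FL" if "u \<in> pverts L" "u' \<in> pverts L" "w \<in> pverts R"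
      "\<not> dot (x (Inl u)) (x (Inr w))" "dot (x (Inl u')) (x (Inr w))" for u u' w
      using no3[OF LR[OF that(1,3,4)] RL[OF that(2,3,5)]] FL by blast
    show "(w, w') \<notin> ?FR" if "u \<in> pverts L" "w \<in> pverts R" "w' \<in> pverts R"
      "\<not> dot (x (Inl u)) (x (Inr w))" "dot (x (Inl u)) (x (Inr w'))" for u w w'
      using no3[OF RL[OF that(1,3,5)] LR[OF that(1,2,4)]] FR by blast
    show "dot (x (Inl u')) (x (Inr w'))" if "u \<in> pverts L" "u' \<in> pverts L" "w \<in> pverts R" "w' \<in> pverts R"
      "\<not> dot (x (Inl u)) (x (Inr w))" "dot (x (Inl u')) (x (Inr w))" "dot (x (Inl u)) (x (Inr w'))"
      for u u' w w'
      using no4[OF LR[OF that(1,3,5)] RL[OF that(2,3,6)] LR RL[OF that(1,4,7)]] that(2,4) by blast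
  qed
  then show False
    using not_one_decyclable_if_inversion_number_ge_2[OF assms(1,5)]
      not_one_decyclable_if_inversion_number_ge_2[OF assms(2,6)] by simp
qed

end
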